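(* Let $(R,+,\cdot)$ be a hyperring and $e\in R$. Then $\Lambda_e^{*}$ is a strongly regular relation both on $(R,+)$ and on $(R,\cdot)$, and the quotient $R/\Lambda_e^{*}$ is a commutative ring with identity $\Lambda_e^{*}(e)$.
   Context: A hyperoperation on a non-empty set $H$ is a map $\circ$ from $H\times H$ to the non-empty subsets of $H$; for non-empty $A,B\subseteq H$, $A\circ B=\bigcup_{a\in A,b\in B}a\circ b$, and elements are identified with singletons. $(H,\circ)$ is a semi-hypergroup if $x\circ(y\circ z)=(x\circ y)\circ z$ for all $x,y,z$, and a hypergroup if moreover $x\circ H=H\circ x=H$ for all $x\in H$. A hyperring $(R,+,\cdot)$ consists of a hypergroup $(R,+)$ (not assumed commutative) and a semi-hypergroup $(R,\cdot)$ (no unit assumed, not assumed commutative) such that $x\cdot(y+z)=x\cdot y+x\cdot z$ and $(x+y)\cdot z=x\cdot z+y\cdot z$ for all $x,y,z\in R$. An equivalence relation $\rho$ on a semi-hypergroup $(H,\circ)$ is strongly regular if for all $x,y,a\in H$ with $x\,\rho\,y$ one has $u\,\rho\,v$ for all $u\in a\circ x$, $v\in a\circ y$, and $u\,\rho\,v$ for all $u\in x\circ a$, $v\in y\circ a$. For $n\in\mathbb{N}=\{1,2,\dots\}$, $k_i\in\mathbb{N}$ and $x_{ij}\in R$, $\sum_{i=1}^{n}\prod_{j=1}^{k_i}x_{ij}$ denotes the subset of $R$ obtained by the iterated hyperoperations, in the indicated order (a product with one factor $x$ is $\{x\}$). $S_n$ is the symmetric group on $\{1,\dots,n\}$. $\alpha_0=\{(x,x)\mid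 x\in R\}$; for $n\ge 1$, $x\,\alpha_n\,y$ iff there exist $(k_1,\dots,k_n)\in\mathbb{N}^n$, $\sigma\in S_n$, and for each $i$ elements $x_{i1},\dots,x_{ik_i}\in R$ and $\sigma_i\in S_{k_i}$ such that $x\in\sum_{i=1}^n\prod_{j=1}^{k_i}x_{ij}$ and $y\in\sum_{i=1}^n A_{\sigma(i)}$, where $A_i=\prod_{j=1}^{k_i}x_{i\,\sigma_i(j)}$; and $\alpha=\bigcup_{n\ge0}\alpha_n$. Condition $\mathfrak{P}_e$: a pair of expressions $\big(\sum_{i=1}^m\prod_{j=1}^{k_i}x_{ij},\ \sum_{i=1}^m\prod_{t=1}^{k'_i}y_{it}\big)$ satisfies $\mathfrak{P}_e$ if one of the following holds: (1) $k_i=k'_i$ and $x_{ij}=y_{ij}$ for all $i,j$; (2) there exist $i_1,\dots,i_d\in\{1,\dots,m\}$ such that for every $i\notin\{i_1,\dots,i_d\}$ one has $k_i=k'_i$ and $x_{it}=y_{it}$ for all $1\le t\le k'_i$, and for every $i\in\{i_1,\dots,i_d\}$ there are $p_i,l_i\in\mathbb{N}$ with $1\le p_i\le l_i\le k'_i$ and $k'_i=k_i+(l_i-p_i+1)$ such that $y_{it}=x_{it}$ if $1\le t<p_i$, $y_{it}=e$ if $p_i\le t\le l_i$, and $y_{it}=x_{i\,(t+p_i-l_i-1)}$ if $l_i<t\le k'_i$ (i.e. a block of consecutive $e$'s is inserted in the $i$-th product). For $m\ge1$, $\Re_e^m$ is the set of all pairs $(A,B)$ and $(B,A)$ where $A=\sum_{i=1}^m\prod_{j=1}^{k_i}x_{ij}$,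 $B=\sum_{i=1}^m\prod_{t=1}^{k'_i}y_{it}$ and the pair $(A,B)$ satisfies $\mathfrak{P}_e$. Define $x\,(\lambda^e_\times)_m\,y$ iff there is $(A,B)\in\Re_e^m$ with $x\in A$, $y\in B$, and $\lambda^e_\times=\bigcup_{m\ge1}(\lambda^e_\times)_m$. $\Lambda_e=\lambda^e_\times\cup\alpha$, and $\Lambda_e^{*}$ is its transitive closure; $\Lambda_e^*(a)$ is the class of $a$. The operations on $R/\Lambda_e^*$ are: $\Lambda_e^{*}(a)\oplus\Lambda_e^{*}(b)=\Lambda_e^{*}(c)$ for any $c\in\Lambda_e^*(a)+\Lambda_e^*(b)$, and $\Lambda_e^{*}(a)\otimes\Lambda_e^{*}(b)=\Lambda_e^{*}(d)$ for any $d\in\Lambda_e^*(a)\cdot\Lambda_e^*(b)$. *)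

theory Defs
  imports "HOL-Algebra.Ring" "HOL-Combinatorics.Permutations"
begin

definition hop_sets :: "('a \<Rightarrow> 'a \<Rightarrow> 'a set) \<Rightarrow> 'a set \<Rightarrow> 'a set \<Rightarrow> 'a set"
  where "hop_sets f A B = (\<Union>a\<in>A. \<Union>b\<in>B. f a b)"

locale semihypergroup =
  fixes H :: "'a set" and f :: "'a \<Rightarrow> 'a \<Rightarrow> 'a set"
  assumes carrier_nonempty: "H \<noteq> {}"
    and hop_subset: "x \<in> H \<Longrightarrow> y \<in> H \<Longrightarrow> f x y \<subseteq> H"
    and hop_nonempty: "x \<in> H \<Longrightarrow> y \<in> H \<Longrightarrow> f x y \<noteq> {}"
    and hop_assoc: "x \<in> H \<Longrightarrow> y \<in> H \<Longrightarrow> z \<in> H \<Longrightarrow>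
      hop_sets f {x} (f y z) = hop_sets f (f x y) {z}"

locale hypergroup = semihypergroup +
  assumes reproducible_left: "x \<in> H \<Longrightarrow> hop_sets f {x} H = H"
    and reproducible_right: "x \<in> H \<Longrightarrow> hop_sets f H {x} = H"

locale hyperring = add: hypergroup R hadd + mul: semihypergroup R hmul
  for R :: "'a set" and hadd hmul :: "'a \<Rightarrow> 'a \<Rightarrow> 'a set" +
  assumes distrib_left: "x \<in> R \<Longrightarrow> y \<in> R \<Longrightarrow> z \<in> R \<Longrightarrow>
      hop_sets hmul {x} (hadd y z) = hop_sets hadd (hmul x y) (hmul x z)"
    and distrib_right: "x \<in> R \<Longrightarrow> y \<in> R \<Longrightarrow> z \<in> R \<Longrightarrow>
      hop_sets hmul (hadd x y) {z} = hop_sets hadd (hmul x z) (hmul y z)"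

definition strongly_regular :: "'a set \<Rightarrow> ('a \<Rightarrow> 'a \<Rightarrow> 'a set) \<Rightarrow> 'a rel \<Rightarrow> bool"
  where "strongly_regular H f \<rho> \<longleftrightarrow> equiv H \<rho> \<and>
    (\<forall>x\<in>H. \<forall>y\<in>H. \<forall>a\<in>H. (x, y) \<in> \<rho> \<longrightarrow>
       (\<forall>u\<in>f a x. \<forall>v\<in>f a y. (u, v) \<in> \<rho>) \<and>
       (\<forall>u\<in>f x a. \<forall>v\<in>f y a. (u, v) \<in> \<rho>))"

text \<open>\<open>hop_iter f n A\<close> is \<open>A 1 \<circ> A 2 \<circ> \<dots> \<circ> A n\<close>, bracketed to the left, for \<open>n \<ge> 1\<close>.
  The value at \<open>n = 0\<close> is junk: all uses below have \<open>n \<ge> 1\<close>.\<close>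

primrec hop_iter :: "('a \<Rightarrow> 'a \<Rightarrow> 'a set) \<Rightarrow> nat \<Rightarrow> (nat \<Rightarrow> 'a set) \<Rightarrow> 'a set"
  where
    "hop_iter f 0 A = {}"
  | "hop_iter f (Suc n) A = (if n = 0 then A 1 else hop_sets f (hop_iter f n A) (A (Suc n)))"

definition hop_prod :: "('a \<Rightarrow> 'a \<Rightarrow> 'a set) \<Rightarrow> nat \<Rightarrow> (nat \<Rightarrow> 'a) \<Rightarrow> 'a set"
  where "hop_prod hmul k x = hop_iter hmul k (\<lambda>j. {x j})"

definition sum_prod ::
  "('a \<Rightarrow> 'a \<Rightarrow> 'a set) \<Rightarrow> ('a \<Rightarrow> 'a \<Rightarrow> 'a set) \<Rightarrow> nat \<Rightarrow> (nat \<Rightarrow> nat) \<Rightarrow> (nat \<Rightarrow> nat \<Rightarrow> 'a) \<Rightarrow> 'a set"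
  where "sum_prod hadd hmul n k x = hop_iter hadd n (\<lambda>i. hop_prod hmul (k i) (x i))"

text \<open>Only the values \<open>k i\<close> and \<open>x i j\<close> with \<open>1 \<le> i \<le> n\<close> and \<open>1 \<le> j \<le> k i\<close> matter.\<close>

definition sum_prod_expr :: "'a set \<Rightarrow> nat \<Rightarrow> (nat \<Rightarrow> nat) \<Rightarrow> (nat \<Rightarrow> nat \<Rightarrow> 'a) \<Rightarrow> bool"
  where "sum_prod_expr R n k x \<longleftrightarrow>
    (\<forall>i\<in>{1..n}. 1 \<le> k i \<and> (\<forall>j\<in>{1..k i}. x i j \<in> R))"

definition alpha_n ::
  "'a set \<Rightarrow> ('a \<Rightarrow> 'a \<Rightarrow> 'a set) \<Rightarrow> ('a \<Rightarrow> 'a \<Rightarrow> 'a set) \<Rightarrow> nat \<Rightarrow> 'a rel"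
  where "alpha_n R hadd hmul n =
    (if n = 0 then Id_on R
     else {(u, v). \<exists>k x \<sigma> \<tau>. sum_prod_expr R n k x \<and>
             \<sigma> permutes {1..n} \<and> (\<forall>i\<in>{1..n}. \<tau> i permutes {1..k i}) \<and>
             u \<in> sum_prod hadd hmul n k x \<and>
             (let A = (\<lambda>i. hop_prod hmul (k i) (\<lambda>j. x i (\<tau> i j)))
              in v \<in> hop_iter hadd n (\<lambda>i. A (\<sigma> i)))})"

definition alpha :: "'a set \<Rightarrow> ('a \<Rightarrow> 'a \<Rightarrow> 'a set) \<Rightarrow> ('a \<Rightarrow> 'a \<Rightarrow> 'a set) \<Rightarrow> 'a rel"
  where "alpha R hadd hmul = (\<Union>n. alpha_n R hadd hmul n)"

text \<open>The set \<open>I\<close> is \<open>{i\<^sub>1, \<dots>, i\<^sub>d}\<close>. The natural-number subtractions never truncate: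
  \<open>p \<le> l\<close>, and \<open>t + p \<ge> l + 2\<close> whenever \<open>l < t\<close>.\<close>

definition cond_P ::
  "'a \<Rightarrow> nat \<Rightarrow> (nat \<Rightarrow> nat) \<Rightarrow> (nat \<Rightarrow> nat \<Rightarrow> 'a) \<Rightarrow> (nat \<Rightarrow> nat) \<Rightarrow> (nat \<Rightarrow> nat \<Rightarrow> 'a) \<Rightarrow> bool"
  where "cond_P e m k x k' y \<longleftrightarrow>
    (\<forall>i\<in>{1..m}. k i = k' i \<and> (\<forall>j\<in>{1..k i}. x i j = y i j)) \<or>
    (\<exists>I. I \<subseteq> {1..m} \<and> I \<noteq> {} \<and>
       (\<forall>i\<in>{1..m} - I. k i = k' i \<and> (\<forall>t\<in>{1..k' i}. x i t = y i t)) \<and>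
       (\<forall>i\<in>I. \<exists>p l. 1 \<le> p \<and> p \<le> l \<and> l \<le> k' i \<and> k' i = k i + (l - p + 1) \<and>
          (\<forall>t\<in>{1..k' i}.
             (t < p \<longrightarrow> y i t = x i t) \<and>
             (p \<le> t \<and> t \<le> l \<longrightarrow> y i t = e) \<and>
             (l < t \<longrightarrow> y i t = x i (t + p - l - 1)))))"

definition Re_rel ::
  "'a set \<Rightarrow> ('a \<Rightarrow> 'a \<Rightarrow> 'a set) \<Rightarrow> ('a \<Rightarrow> 'a \<Rightarrow> 'a set) \<Rightarrow> 'a \<Rightarrow> nat \<Rightarrow> 'a set rel"
  where "Re_rel R hadd hmul e m =
    (let P = {(A, B). \<exists>k x k' y. sum_prod_expr R m k x \<and> sum_prod_expr R m k' y \<and>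
                cond_P e m k x k' y \<and>
                A = sum_prod hadd hmul m k x \<and> B = sum_prod hadd hmul m k' y}
     in P \<union> P\<inverse>)"

definition lambda_m ::
  "'a set \<Rightarrow> ('a \<Rightarrow> 'a \<Rightarrow> 'a set) \<Rightarrow> ('a \<Rightarrow> 'a \<Rightarrow> 'a set) \<Rightarrow> 'a \<Rightarrow> nat \<Rightarrow> 'a rel"
  where "lambda_m R hadd hmul e m =
    {(u, v). \<exists>(A, B) \<in> Re_rel R hadd hmul e m. u \<in> A \<and> v \<in> B}"

definition lambda_times ::
  "'a set \<Rightarrow> ('a \<Rightarrow> 'a \<Rightarrow> 'a set) \<Rightarrow> ('a \<Rightarrow> 'a \<Rightarrow> 'a set) \<Rightarrow> 'a \<Rightarrow> 'a rel"
  where "lambda_times R hadd hmul e = (\<Union>m\<in>{1..}. lambda_m R hadd hmul e m)"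

definition Lambda ::
  "'a set \<Rightarrow> ('a \<Rightarrow> 'a \<Rightarrow> 'a set) \<Rightarrow> ('a \<Rightarrow> 'a \<Rightarrow> 'a set) \<Rightarrow> 'a \<Rightarrow> 'a rel"
  where "Lambda R hadd hmul e = lambda_times R hadd hmul e \<union> alpha R hadd hmul"

definition Lambda_star ::
  "'a set \<Rightarrow> ('a \<Rightarrow> 'a \<Rightarrow> 'a set) \<Rightarrow> ('a \<Rightarrow> 'a \<Rightarrow> 'a set) \<Rightarrow> 'a \<Rightarrow> 'a rel"
  where "Lambda_star R hadd hmul e = (Lambda R hadd hmul e)\<^sup>+"

text \<open>The common class of all elements of \<open>X \<circ> Y\<close>; meaningful once these elements are known
  to be \<open>\<rho>\<close>-equivalent.\<close>

definition quot_op :: "('a \<Rightarrow> 'a \<Rightarrow> 'a set) \<Rightarrow> 'a rel \<Rightarrow> 'a set \<Rightarrow> 'a set \<Rightarrow> 'a set"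
  where "quot_op f \<rho> X Y = (THE Z. \<forall>c\<in>hop_sets f X Y. Z = \<rho> `` {c})"

text \<open>The record format requires a zero; it is the neutral element of the quotient addition.\<close>

definition quot_ring ::
  "'a set \<Rightarrow> ('a \<Rightarrow> 'a \<Rightarrow> 'a set) \<Rightarrow> ('a \<Rightarrow> 'a \<Rightarrow> 'a set) \<Rightarrow> 'a rel \<Rightarrow> 'a \<Rightarrow> 'a set ring"
  where "quot_ring R hadd hmul \<rho> e =
    \<lparr>carrier = R // \<rho>,
     monoid.mult = quot_op hmul \<rho>,
     one = \<rho> `` {e},
     zero = (THE Z. Z \<in> R // \<rho> \<and>
               (\<forall>X\<in>R // \<rho>. quot_op hadd \<rho> X Z = X \<and> quot_op hadd \<rho> Z X = X)),
     add = quot_op hadd \<rho>\<rparr>"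

end

theory Submission imports Defs begin

text \<open>
  Write \<open>\<Lambda>\<close> for the union of \<open>\<lambda>\<^sup>e\<^sub>\<times>\<close> and \<open>\<alpha>\<close>, and \<open>\<Lambda>\<^sup>*\<close> for its transitive closure.
  \<open>\<alpha>\<close> relates every element of \<open>x + y\<close> to every element of \<open>y + x\<close>, and every element of
  \<open>x \<cdot> y\<close> to every element of \<open>y \<cdot> x\<close>; it is there to make both quotient operations commutative.
  \<open>\<lambda>\<^sup>e\<^sub>\<times>\<close> relates \<open>x\<close> to every element of \<open>x \<cdot> e\<close>; it is there to make the class of \<open>e\<close> an
  identity.

  Since commutativity is built into \<open>\<Lambda>\<close>, strong regularity of \<open>\<Lambda>\<^sup>*\<close> needs to be checked on one
  side only: \<open>a \<circ> x\<close> is \<open>\<Lambda>\<close>-related to \<open>x \<circ> a\<close>, this to \<open>y \<circ> a\<close>, and this to \<open>a \<circ> y\<close>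
  (\<open>strongly_regular_trancl\<close>). Working on the right is convenient, because there a
  witness for \<open>x \<Lambda> y\<close> is extended without shifting any index: \<open>x + a\<close> is covered by
  appending the summand \<open>a\<close> to the sum, and \<open>x \<cdot> a\<close> by appending the factor \<open>a\<close> to every
  product, by distributivity. The permutations of the witness fix the new last
  index, and the blocks of \<open>e\<close> stay where they are
  (\<open>alpha_add_right\<close>, \<open>alpha_mult_right\<close>, \<open>insertion_rel_add_right\<close>,
  \<open>insertion_rel_mult_right\<close>).

  The quotient by a strongly regular relation has single-valued operations, computed on any
  representatives (\<open>quot_op_classes\<close>, \<open>quot_op_eq\<close>), so associativity and distributivity are inherited from \<open>R\<close>. A
  commutative semigroup in which all equations \<open>a + y = b\<close> are solvable is a group,
  and this solvability is the reproduction axiom of \<open>(R, +)\<close>.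
\<close>

section \<open>Strongly regular relations and quotient operations\<close>

lemma hop_setsI: "a \<in> A \<Longrightarrow> b \<in> B \<Longrightarrow> u \<in> f a b \<Longrightarrow> u \<in> hop_sets f A B"
  by (auto simp: hop_sets_def)

lemma hop_setsE:
  assumes "u \<in> hop_sets f A B"
  obtains a b where "a \<in> A" "b \<in> B" "u \<in> f a b"
  using assms by (auto simp: hop_sets_def)

lemma strongly_regularD:
  assumes "strongly_regular H f \<rho>" "(x, y) \<in> \<rho>" "a \<in> H"
  shows "u \<in> f a x \<Longrightarrow> v \<in> f a y \<Longrightarrow> (u, v) \<in> \<rho>"
    and "u \<in> f x a \<Longrightarrow> v \<in> f y a \<Longrightarrow> (u, v) \<in> \<rho>"
proof -
  have "x \<in> H" "y \<in> H"
    using assms(1,2) unfolding strongly_regular_def equiv_def refl_on_def by auto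
  then show "u \<in> f a x \<Longrightarrow> v \<in> f a y \<Longrightarrow> (u, v) \<in> \<rho>"
    and "u \<in> f x a \<Longrightarrow> v \<in> f y a \<Longrightarrow> (u, v) \<in> \<rho>"
    using assms unfolding strongly_regular_def by blast+
qed

context semihypergroup
begin

text \<open>Compatibility on the right passes along a chain of \<open>r\<close>-steps because hyperproducts are
  non-empty, so that each intermediate element of the chain contributes an intermediate element.
  Compatibility on the left is then obtained by commuting, going across, and commuting back.\<close>

lemma strongly_regular_trancl:
  assumes subset: "r \<subseteq> H \<times> H" and refl: "\<And>x. x \<in> H \<Longrightarrow> (x, x) \<in> r" and "sym r"
    and comm: "\<And>x a u v. x \<in> H \<Longrightarrow> a \<in> H \<Longrightarrow> u \<in> f x a \<Longrightarrow> v \<in> f a x \<Longrightarrow> (u, v) \<in> r"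
    and right: "\<And>x y a u v. (x, y) \<in> r \<Longrightarrow> a \<in> H \<Longrightarrow> u \<in> f x a \<Longrightarrow> v \<in> f y a \<Longrightarrow> (u, v) \<in> r"
  shows "strongly_regular H f (r\<^sup>+)"
proof -
  have sub: "r\<^sup>+ \<subseteq> H \<times> H"
    using subset by (rule trancl_subset_Sigma)
  have equiv: "equiv H (r\<^sup>+)"
    using sub refl \<open>sym r\<close> by (auto simp: equiv_def refl_on_def sym_trancl)
  have right': "(u, v) \<in> r\<^sup>+" if xy: "(x, y) \<in> r\<^sup>+" and "a \<in> H" "u \<in> f x a" "v \<in> f y a" for x y a u v
    using xy \<open>v \<in> f y a\<close>
  proof (induction arbitrary: v)
    case (base y)
    then show ?case using right \<open>a \<in> H\<close> \<open>u \<in> f x a\<close> by blast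
  next
    case (step y z)
    have "y \<in> H" using step.hyps(2) subset by blast
    then obtain w where w: "w \<in> f y a" using hop_nonempty \<open>a \<in> H\<close> by blast
    show ?case
      using step.IH[OF w] right[OF step.hyps(2) \<open>a \<in> H\<close> w step.prems] by (rule trancl_into_trancl)
  qed
  have left': "(u, v) \<in> r\<^sup>+" if xy: "(x, y) \<in> r\<^sup>+" and "a \<in> H" "u \<in> f a x" "v \<in> f a y" for x y a u v
  proof -
    have "x \<in> H" "y \<in> H" using xy sub by auto
    then obtain u' v' where w: "u' \<in> f x a" "v' \<in> f y a" using hop_nonempty \<open>a \<in> H\<close> by blast
    have "(u, u') \<in> r" "(v', v) \<in> r"
      using comm that w \<open>x \<in> H\<close> \<open>y \<in> H\<close> by blast+
    then show ?thesis using right'[OF xy \<open>a \<in> H\<close> w] by (meson r_into_trancl trancl_trans)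
  qed
  show ?thesis
    unfolding strongly_regular_def using equiv left' right' by blast
qed

text \<open>Two hyperproducts \<open>a1 \<circ> b1\<close> and \<open>a2 \<circ> b2\<close> of equivalent elements are compared through an
  element of \<open>a1 \<circ> b2\<close>, changing one argument at a time.\<close>

lemma quot_op_classes:
  assumes sr: "strongly_regular H f \<rho>" and "c \<in> hop_sets f (\<rho> `` {a}) (\<rho> `` {b})"
  shows "quot_op f \<rho> (\<rho> `` {a}) (\<rho> `` {b}) = \<rho> `` {c}"
proof -
  have eq: "equiv H \<rho>" using sr by (simp add: strongly_regular_def)
  have sub: "\<rho> \<subseteq> H \<times> H" using eq by (auto simp: equiv_def refl_on_def)
  obtain a1 b1 where 1: "(a, a1) \<in> \<rho>" "(b, b1) \<in> \<rho>" "c \<in> f a1 b1"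
    using assms(2) unfolding hop_sets_def by blast
  have sym: "sym \<rho>" and trans: "trans \<rho>" using eq by (auto elim: equivE)
  have same: "\<rho> `` {d} = \<rho> `` {c}" if d: "d \<in> hop_sets f (\<rho> `` {a}) (\<rho> `` {b})" for d
  proof -
    obtain a2 b2 where 2: "(a, a2) \<in> \<rho>" "(b, b2) \<in> \<rho>" "d \<in> f a2 b2"
      using d unfolding hop_sets_def by blast
    have rel: "(a2, a1) \<in> \<rho>" "(b2, b1) \<in> \<rho>"
      using 1 2 symD[OF sym] transD[OF trans] by blast+
    have H: "a1 \<in> H" "b1 \<in> H" "a2 \<in> H" "b2 \<in> H" using rel sub by auto
    obtain w where w: "w \<in> f a1 b2" using hop_nonempty H by blast
    have "(d, w) \<in> \<rho>" using strongly_regularD(2)[OF sr rel(1)] H 2 w by blast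
    moreover have "(w, c) \<in> \<rho>" using strongly_regularD(1)[OF sr rel(2)] H 1 w by blast
    ultimately have "(d, c) \<in> \<rho>" by (rule transD[OF trans])
    then show ?thesis using eq by (rule equiv_class_eq[rotated])
  qed
  show ?thesis
    unfolding quot_op_def
  proof (rule the_equality)
    show "\<forall>d\<in>hop_sets f (\<rho> `` {a}) (\<rho> `` {b}). \<rho> `` {c} = \<rho> `` {d}"
      by (intro ballI same[symmetric])
  qed (use assms(2) in blast)
qed

lemma quot_op_eq:
  assumes "strongly_regular H f \<rho>" "a \<in> H" "b \<in> H" "c \<in> f a b"
  shows "quot_op f \<rho> (\<rho> `` {a}) (\<rho> `` {b}) = \<rho> `` {c}"
proof -
  have "equiv H \<rho>" using assms(1) by (simp add: strongly_regular_def)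
  note self = equiv_class_self[OF this]
  show ?thesis
    by (rule quot_op_classes[OF assms(1) hop_setsI[where f = f, OF self[OF assms(2)] self[OF assms(3)] assms(4)]])
qed

lemma quot_op_closed:
  assumes "strongly_regular H f \<rho>" "X \<in> H // \<rho>" "Y \<in> H // \<rho>"
  shows "quot_op f \<rho> X Y \<in> H // \<rho>"
proof -
  obtain a b where ab: "a \<in> H" "b \<in> H" "X = \<rho> `` {a}" "Y = \<rho> `` {b}"
    using assms by (auto elim!: quotientE)
  then obtain c where c: "c \<in> f a b" "c \<in> H" using hop_nonempty hop_subset by blast
  show ?thesis
    using quot_op_eq[OF assms(1) ab(1,2) c(1)] ab c(2) by (simp add: quotientI)
qed

lemma quot_op_assoc:
  assumes sr: "strongly_regular H f \<rho>" and "X \<in> H // \<rho>" "Y \<in> H // \<rho>" "Z \<in> H // \<rho>"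
  shows "quot_op f \<rho> (quot_op f \<rho> X Y) Z = quot_op f \<rho> X (quot_op f \<rho> Y Z)"
proof -
  obtain a b c where abc: "a \<in> H" "b \<in> H" "c \<in> H"
    and XYZ: "X = \<rho> `` {a}" "Y = \<rho> `` {b}" "Z = \<rho> `` {c}"
    using assms by (auto elim!: quotientE)
  obtain p where p: "p \<in> f b c" "p \<in> H" using hop_nonempty hop_subset abc by blast
  obtain w where w: "w \<in> f a p" using hop_nonempty abc p by blast
  have "w \<in> hop_sets f (f a b) {c}"
    using hop_assoc[OF abc] p w by (auto intro: hop_setsI)
  then obtain q where q: "q \<in> f a b" "w \<in> f q c" by (auto elim: hop_setsE)
  have "q \<in> H" using q hop_subset abc by blast
  then show ?thesis
    using quot_op_eq[OF sr] abc p q w by (simp add: XYZ)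
qed

lemma quot_op_comm:
  assumes sr: "strongly_regular H f \<rho>"
    and comm: "\<And>x y u v. x \<in> H \<Longrightarrow> y \<in> H \<Longrightarrow> u \<in> f x y \<Longrightarrow> v \<in> f y x \<Longrightarrow> (u, v) \<in> \<rho>"
    and "X \<in> H // \<rho>" "Y \<in> H // \<rho>"
  shows "quot_op f \<rho> X Y = quot_op f \<rho> Y X"
proof -
  obtain a b where ab: "a \<in> H" "b \<in> H" and XY: "X = \<rho> `` {a}" "Y = \<rho> `` {b}"
    using assms by (auto elim!: quotientE)
  obtain c d where cd: "c \<in> f a b" "d \<in> f b a" using hop_nonempty ab by blast
  have "equiv H \<rho>" using sr by (simp add: strongly_regular_def)
  then have "\<rho> `` {c} = \<rho> `` {d}" using comm[OF ab cd] by (rule equiv_class_eq)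
  then show ?thesis using quot_op_eq[OF sr] ab cd by (simp add: XY)
qed

end

context hypergroup
begin

text \<open>The reproduction axiom survives in the quotient as solvability of equations.\<close>

lemma quot_op_solvable:
  assumes sr: "strongly_regular H f \<rho>" and "X \<in> H // \<rho>" "Y \<in> H // \<rho>"
  shows "\<exists>Z\<in>H // \<rho>. quot_op f \<rho> Z X = Y"
proof -
  obtain a b where ab: "a \<in> H" "b \<in> H" and XY: "X = \<rho> `` {a}" "Y = \<rho> `` {b}"
    using assms by (auto elim!: quotientE)
  have "b \<in> hop_sets f H {a}" using reproducible_right ab by blast
  then obtain z where z: "z \<in> H" "b \<in> f z a" by (auto elim: hop_setsE)
  then show ?thesis using quot_op_eq[OF sr z(1) ab(1) z(2)] by (auto simp: XY intro: quotientI)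
qed

text \<open>If \<open>Z\<close> fixes one class \<open>X\<close>, then it fixes every class, because every class has the form
  \<open>W + X\<close>.\<close>

lemma quot_op_neutral_ex1:
  assumes sr: "strongly_regular H f \<rho>"
    and comm: "\<And>X Y. X \<in> H // \<rho> \<Longrightarrow> Y \<in> H // \<rho> \<Longrightarrow> quot_op f \<rho> X Y = quot_op f \<rho> Y X"
  shows "\<exists>!Z. Z \<in> H // \<rho> \<and> (\<forall>X\<in>H // \<rho>. quot_op f \<rho> X Z = X \<and> quot_op f \<rho> Z X = X)"
proof -
  obtain X where X: "X \<in> H // \<rho>"
    using carrier_nonempty by (auto intro: quotientI)
  obtain Z where Z: "Z \<in> H // \<rho>" "quot_op f \<rho> Z X = X"
    using quot_op_solvable[OF sr X X] by blast
  have "quot_op f \<rho> Y Z = Y" if Y: "Y \<in> H // \<rho>" for Y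
  proof -
    obtain W where W: "W \<in> H // \<rho>" "quot_op f \<rho> W X = Y"
      using quot_op_solvable[OF sr X Y] by blast
    then show ?thesis using quot_op_assoc[OF sr W(1) X Z(1)] comm[OF X Z(1)] Z(2) by simp
  qed
  then have neutral: "\<forall>X\<in>H // \<rho>. quot_op f \<rho> X Z = X \<and> quot_op f \<rho> Z X = X"
    using comm[OF _ Z(1)] by metis
  show ?thesis
  proof (rule ex1I[of _ Z])
    fix Z' assume "Z' \<in> H // \<rho> \<and> (\<forall>X\<in>H // \<rho>. quot_op f \<rho> X Z' = X \<and> quot_op f \<rho> Z' X = X)"
    then show "Z' = Z" using neutral Z(1) by metis
  qed (use neutral Z(1) in blast)
qed

end

context hyperring
begin

lemma quot_op_distrib_right:
  assumes sra: "strongly_regular R hadd \<rho>" and srm: "strongly_regular R hmul \<rho>"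
    and "X \<in> R // \<rho>" "Y \<in> R // \<rho>" "Z \<in> R // \<rho>"
  shows "quot_op hmul \<rho> (quot_op hadd \<rho> X Y) Z
    = quot_op hadd \<rho> (quot_op hmul \<rho> X Z) (quot_op hmul \<rho> Y Z)"
proof -
  obtain a b c where abc: "a \<in> R" "b \<in> R" "c \<in> R"
    and XYZ: "X = \<rho> `` {a}" "Y = \<rho> `` {b}" "Z = \<rho> `` {c}"
    using assms by (auto elim!: quotientE)
  obtain s where s: "s \<in> hadd a b" "s \<in> R"
    using add.hop_nonempty add.hop_subset abc by blast
  obtain w where w: "w \<in> hmul s c" using mul.hop_nonempty s abc by blast
  have "w \<in> hop_sets hadd (hmul a c) (hmul b c)"
    using distrib_right[OF abc] s w by (auto intro: hop_setsI)
  then obtain p q where pq: "p \<in> hmul a c" "q \<in> hmul b c" "w \<in> hadd p q" by (auto elim: hop_setsE)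
  have "p \<in> R" "q \<in> R" using pq mul.hop_subset abc by blast+
  then show ?thesis
    using add.quot_op_eq[OF sra] mul.quot_op_eq[OF srm] abc s w pq by (simp add: XYZ)
qed

lemma quot_ring_cring:
  assumes sra: "strongly_regular R hadd \<rho>" and srm: "strongly_regular R hmul \<rho>"
    and comm_add: "\<And>x y u v. x \<in> R \<Longrightarrow> y \<in> R \<Longrightarrow> u \<in> hadd x y \<Longrightarrow> v \<in> hadd y x \<Longrightarrow> (u, v) \<in> \<rho>"
    and comm_mul: "\<And>x y u v. x \<in> R \<Longrightarrow> y \<in> R \<Longrightarrow> u \<in> hmul x y \<Longrightarrow> v \<in> hmul y x \<Longrightarrow> (u, v) \<in> \<rho>"
    and "e \<in> R" and unit: "\<And>x u. x \<in> R \<Longrightarrow> u \<in> hmul x e \<Longrightarrow> (x, u) \<in> \<rho>"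
  shows "cring (quot_ring R hadd hmul \<rho> e)" (is "cring ?Q")
proof -
  have eq: "equiv R \<rho>" using sra by (simp add: strongly_regular_def)
  have E: "\<rho> `` {e} \<in> R // \<rho>" using \<open>e \<in> R\<close> by (rule quotientI)
  have ca: "quot_op hadd \<rho> X Y = quot_op hadd \<rho> Y X" if "X \<in> R // \<rho>" "Y \<in> R // \<rho>" for X Y
    using comm_add that by (rule add.quot_op_comm[OF sra])
  have cm: "quot_op hmul \<rho> X Y = quot_op hmul \<rho> Y X" if "X \<in> R // \<rho>" "Y \<in> R // \<rho>" for X Y
    using comm_mul that by (rule mul.quot_op_comm[OF srm])
  define Z where "Z = (THE Z. Z \<in> R // \<rho> \<and>
    (\<forall>X\<in>R // \<rho>. quot_op hadd \<rho> X Z = X \<and> quot_op hadd \<rho> Z X = X))"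
  have Z: "Z \<in> R // \<rho>" "\<And>X. X \<in> R // \<rho> \<Longrightarrow> quot_op hadd \<rho> Z X = X"
    using theI'[OF add.quot_op_neutral_ex1[OF sra ca]] unfolding Z_def by blast+
  have r_one: "quot_op hmul \<rho> X (\<rho> `` {e}) = X" if X: "X \<in> R // \<rho>" for X
  proof -
    obtain a where a: "a \<in> R" "X = \<rho> `` {a}" using X by (auto elim!: quotientE)
    obtain c where c: "c \<in> hmul a e" using mul.hop_nonempty a \<open>e \<in> R\<close> by blast
    have "\<rho> `` {a} = \<rho> `` {c}" using unit a c eq by (intro equiv_class_eq) auto
    then show ?thesis using mul.quot_op_eq[OF srm a(1) \<open>e \<in> R\<close> c] a by simp
  qed
  have simps: "carrier ?Q = R // \<rho>" "\<And>X Y. X \<oplus>\<^bsub>?Q\<^esub> Y = quot_op hadd \<rho> X Y"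
    "\<And>X Y. X \<otimes>\<^bsub>?Q\<^esub> Y = quot_op hmul \<rho> X Y" "\<zero>\<^bsub>?Q\<^esub> = Z" "\<one>\<^bsub>?Q\<^esub> = \<rho> `` {e}"
    by (simp_all add: quot_ring_def Z_def)
  have "abelian_group ?Q"
    by (rule abelian_groupI, unfold simps)
      (fact add.quot_op_closed[OF sra] Z add.quot_op_assoc[OF sra] ca
        add.quot_op_solvable[OF sra _ Z(1)])+
  moreover have "Group.comm_monoid ?Q"
  proof (rule comm_monoidI, unfold simps)
    show "quot_op hmul \<rho> (\<rho> `` {e}) X = X" if "X \<in> R // \<rho>" for X
      using cm[OF E that] r_one[OF that] by simp
  qed (fact mul.quot_op_closed[OF srm] E mul.quot_op_assoc[OF srm] cm)+
  ultimately show ?thesis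
    by (rule cringI, unfold simps) (rule quot_op_distrib_right[OF sra srm])
qed

end

section \<open>Sums of products\<close>

lemma hop_iter_cong:
  assumes "\<And>i. i \<in> {1..n} \<Longrightarrow> A i = B i"
  shows "hop_iter f n A = hop_iter f n B"
  using assms by (induction n) auto

lemma hop_prod_1 [simp]: "hop_prod hmul (Suc 0) x = {x 1}"
  by (simp add: hop_prod_def)

lemma sum_prod_1 [simp]: "sum_prod hadd hmul (Suc 0) k x = hop_prod hmul (k 1) (x 1)"
  by (simp add: sum_prod_def)

lemma hop_prod_append:
  assumes "1 \<le> k"
  shows "hop_prod hmul (Suc k) (x(Suc k := a)) = hop_sets hmul (hop_prod hmul k x) {a}"
proof -
  have "hop_iter hmul k (\<lambda>j. {(x(Suc k := a)) j}) = hop_iter hmul k (\<lambda>j. {x j})"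
    by (rule hop_iter_cong) auto
  then show ?thesis using assms by (simp add: hop_prod_def)
qed

lemma sum_prod_append:
  assumes "1 \<le> n" "u \<in> sum_prod hadd hmul n k x" "w \<in> hadd u a"
  shows "w \<in> sum_prod hadd hmul (Suc n) (k(Suc n := 1)) (x(Suc n := \<lambda>_. a))"
proof -
  have "hop_iter hadd n (\<lambda>i. hop_prod hmul ((k(Suc n := 1)) i) ((x(Suc n := \<lambda>_. a)) i))
      = sum_prod hadd hmul n k x"
    unfolding sum_prod_def by (rule hop_iter_cong) auto
  then show ?thesis using assms by (auto simp: sum_prod_def intro: hop_setsI)
qed

lemma sum_prod_expr_append:
  assumes "sum_prod_expr R n k x" "a \<in> R"
  shows "sum_prod_expr R (Suc n) (k(Suc n := 1)) (x(Suc n := \<lambda>_. a))"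
  using assms by (auto simp: sum_prod_expr_def)

lemma sum_prod_expr_append_factor:
  assumes "sum_prod_expr R n k x" "a \<in> R"
  shows "sum_prod_expr R n (\<lambda>i. Suc (k i)) (\<lambda>i. (x i)(Suc (k i) := a))"
  using assms by (auto simp: sum_prod_expr_def)

lemma (in semihypergroup) hop_sets_closed:
  assumes "A \<subseteq> H" "B \<subseteq> H"
  shows "hop_sets f A B \<subseteq> H"
  using assms hop_subset by (fastforce simp: hop_sets_def)

lemma (in semihypergroup) hop_iter_closed:
  assumes "\<And>i. i \<in> {1..n} \<Longrightarrow> A i \<subseteq> H"
  shows "hop_iter f n A \<subseteq> H"
  using assms
proof (induction n)
  case (Suc n)
  have "hop_iter f n A \<subseteq> H" by (rule Suc.IH) (use Suc.prems in auto)
  then show ?case using Suc.prems hop_sets_closed by auto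
qed simp

context hyperring
begin

lemma hop_prod_closed:
  assumes "\<And>j. j \<in> {1..k} \<Longrightarrow> x j \<in> R"
  shows "hop_prod hmul k x \<subseteq> R"
  unfolding hop_prod_def using assms by (intro mul.hop_iter_closed) auto

lemma sum_prod_closed:
  assumes "sum_prod_expr R n k x"
  shows "sum_prod hadd hmul n k x \<subseteq> R"
  unfolding sum_prod_def using assms
  by (intro add.hop_iter_closed hop_prod_closed) (auto simp: sum_prod_expr_def)

text \<open>Iterated distributivity turns a witness for \<open>u\<close> into one for the elements of \<open>u \<cdot> a\<close>.\<close>

lemma hop_iter_mult_right:
  assumes "\<And>i. i \<in> {1..n} \<Longrightarrow> A i \<subseteq> R" "a \<in> R" "u \<in> hop_iter hadd n A" "w \<in> hmul u a"
  shows "w \<in> hop_iter hadd n (\<lambda>i. hop_sets hmul (A i) {a})"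
  using assms
proof (induction n arbitrary: u w)
  case (Suc n)
  show ?case
  proof (cases "n = 0")
    case True
    then show ?thesis using Suc.prems by (auto simp: hop_sets_def)
  next
    case False
    then obtain p q where pq: "p \<in> hop_iter hadd n A" "q \<in> A (Suc n)" "u \<in> hadd p q"
      using Suc.prems(3) by (auto elim: hop_setsE)
    have "hop_iter hadd n A \<subseteq> R" by (rule add.hop_iter_closed) (use Suc.prems(1) in auto)
    then have R: "p \<in> R" "q \<in> R" using pq Suc.prems(1)[of "Suc n"] by auto
    have "w \<in> hop_sets hmul (hadd p q) {a}" using pq(3) Suc.prems(4) by (auto simp: hop_sets_def)
    then have "w \<in> hop_sets hadd (hmul p a) (hmul q a)" by (simp only: distrib_right[OF R Suc.prems(2)])
    then obtain p' q' where pq': "p' \<in> hmul p a" "q' \<in> hmul q a" "w \<in> hadd p' q'"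
      by (auto simp: hop_sets_def)
    have "p' \<in> hop_iter hadd n (\<lambda>i. hop_sets hmul (A i) {a})"
      by (rule Suc.IH[OF _ \<open>a \<in> R\<close> pq(1) pq'(1)]) (use Suc.prems in auto)
    moreover have "q' \<in> hop_sets hmul (A (Suc n)) {a}" using pq pq' by (auto simp: hop_sets_def)
    ultimately show ?thesis using False pq'(3) by (auto simp: hop_sets_def)
  qed
qed simp

lemma sum_prod_append_factor:
  assumes x: "sum_prod_expr R n k x" and a: "a \<in> R" and uw: "u \<in> sum_prod hadd hmul n k x" "w \<in> hmul u a"
  shows "w \<in> sum_prod hadd hmul n (\<lambda>i. Suc (k i)) (\<lambda>i. (x i)(Suc (k i) := a))"
proof -
  have "w \<in> hop_iter hadd n (\<lambda>i. hop_sets hmul (hop_prod hmul (k i) (x i)) {a})"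
    by (rule hop_iter_mult_right[OF _ a uw(1)[unfolded sum_prod_def] uw(2)])
      (use x in \<open>auto simp: sum_prod_expr_def dest!: hop_prod_closed[THEN subsetD, rotated]\<close>)
  also have "\<dots> = sum_prod hadd hmul n (\<lambda>i. Suc (k i)) (\<lambda>i. (x i)(Suc (k i) := a))"
    unfolding sum_prod_def
    by (rule hop_iter_cong) (use x in \<open>simp add: hop_prod_append sum_prod_expr_def\<close>)
  finally show ?thesis .
qed

end

section \<open>The permutation relation\<close>

text \<open>The permuted sum of products is itself a sum of products, with exponents
  \<open>k \<circ> \<sigma>\<close>; so the two sides of \<open>\<alpha>\<close> can be handled by the same lemmas.\<close>

abbreviation permuted :: "(nat \<Rightarrow> nat) \<Rightarrow> (nat \<Rightarrow> nat \<Rightarrow> nat) \<Rightarrow> (nat \<Rightarrow> nat \<Rightarrow> 'a) \<Rightarrow> nat \<Rightarrow> nat \<Rightarrow> 'a"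
  where "permuted \<sigma> \<tau> x \<equiv> \<lambda>i j. x (\<sigma> i) (\<tau> (\<sigma> i) j)"

context hyperring
begin

lemma alphaI:
  assumes "1 \<le> n" "sum_prod_expr R n k x" "\<sigma> permutes {1..n}"
    "\<And>i. i \<in> {1..n} \<Longrightarrow> \<tau> i permutes {1..k i}"
    "u \<in> sum_prod hadd hmul n k x" "v \<in> sum_prod hadd hmul n (k \<circ> \<sigma>) (permuted \<sigma> \<tau> x)"
  shows "(u, v) \<in> alpha R hadd hmul"
proof -
  have "n \<noteq> 0" using assms(1) by simp
  then have "(u, v) \<in> alpha_n R hadd hmul n"
    unfolding alpha_n_def Let_def if_not_P[OF \<open>n \<noteq> 0\<close>] mem_Collect_eq case_prod_conv
    by (intro exI[of _ k] exI[of _ x] exI[of _ \<sigma>] exI[of _ \<tau>] conjI ballI assms(2-5)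
        assms(6)[unfolded sum_prod_def comp_def])
  then show ?thesis by (auto simp: alpha_def)
qed

text \<open>The diagonal \<open>\<alpha>\<^sub>0\<close> is contained in \<open>\<alpha>\<^sub>1\<close>, as \<open>x\<close> is a one-factor product;
  so \<open>n \<ge> 1\<close> may always be supposed.\<close>

lemma alphaE:
  assumes "(u, v) \<in> alpha R hadd hmul"
  obtains n k x \<sigma> \<tau> where "1 \<le> n" "sum_prod_expr R n k x" "\<sigma> permutes {1..n}"
    "\<And>i. i \<in> {1..n} \<Longrightarrow> \<tau> i permutes {1..k i}"
    "u \<in> sum_prod hadd hmul n k x" "v \<in> sum_prod hadd hmul n (k \<circ> \<sigma>) (permuted \<sigma> \<tau> x)"
proof -
  obtain n where n: "(u, v) \<in> alpha_n R hadd hmul n" using assms by (auto simp: alpha_def)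
  show ?thesis
  proof (cases "n = 0")
    case True
    then have "u = v" "u \<in> R" using n by (auto simp: alpha_n_def)
    then show ?thesis
      by (intro that[of 1 "\<lambda>_. 1" "\<lambda>_ _. u" id "\<lambda>_. id"]) (auto simp: sum_prod_expr_def permutes_id)
  next
    case False
    then obtain k x \<sigma> \<tau> where "sum_prod_expr R n k x" "\<sigma> permutes {1..n}"
        "\<forall>i\<in>{1..n}. \<tau> i permutes {1..k i}" "u \<in> sum_prod hadd hmul n k x"
        "v \<in> sum_prod hadd hmul n (k \<circ> \<sigma>) (permuted \<sigma> \<tau> x)"
      using n unfolding alpha_n_def Let_def if_not_P[OF False] mem_Collect_eq case_prod_conv
        sum_prod_def comp_def by (elim exE conjE)
    then show ?thesis using False by (intro that[of n k x \<sigma> \<tau>]) auto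
  qed
qed

lemma permuted_expr:
  assumes x: "sum_prod_expr R n k x" and \<sigma>: "\<sigma> permutes {1..n}"
    and \<tau>: "\<And>i. i \<in> {1..n} \<Longrightarrow> \<tau> i permutes {1..k i}"
  shows "sum_prod_expr R n (k \<circ> \<sigma>) (permuted \<sigma> \<tau> x)"
  unfolding sum_prod_expr_def
proof (intro ballI conjI)
  fix i assume i: "i \<in> {1..n}"
  then have si: "\<sigma> i \<in> {1..n}" using permutes_in_image[OF \<sigma>] by blast
  show "1 \<le> (k \<circ> \<sigma>) i" using x si by (auto simp: sum_prod_expr_def)
  fix j assume "j \<in> {1..(k \<circ> \<sigma>) i}"
  then have "\<tau> (\<sigma> i) j \<in> {1..k (\<sigma> i)}" using permutes_in_image[OF \<tau>[OF si]] by simp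
  then show "permuted \<sigma> \<tau> x i j \<in> R" using x si by (auto simp: sum_prod_expr_def)
qed

lemma alpha_subset: "alpha R hadd hmul \<subseteq> R \<times> R"
proof (clarify, elim alphaE)
  fix u v n k x \<sigma> \<tau>
  assume *: "sum_prod_expr R n k x" "\<sigma> permutes {1..n}" "\<And>i. i \<in> {1..n} \<Longrightarrow> \<tau> i permutes {1..k i}"
    "u \<in> sum_prod hadd hmul n k x" "v \<in> sum_prod hadd hmul n (k \<circ> \<sigma>) (permuted \<sigma> \<tau> x)"
  then show "u \<in> R \<and> v \<in> R"
    using sum_prod_closed[OF *(1)] sum_prod_closed[OF permuted_expr[OF *(1-3)]] by blast
qed

text \<open>Undoing the permutations from the permuted expression: the inverse of \<open>\<sigma>\<close> rearranges the
  summands, and the \<open>i\<close>-th permuted summand needs the inverse of \<open>\<tau> (\<sigma> i)\<close>.\<close>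

lemma alpha_sym: "sym (alpha R hadd hmul)"
proof (rule symI, elim alphaE)
  fix u v n k x \<sigma> \<tau>
  assume n: "1 \<le> n" and x: "sum_prod_expr R n k x" and \<sigma>: "\<sigma> permutes {1..n}"
    and \<tau>: "\<And>i. i \<in> {1..n} \<Longrightarrow> \<tau> i permutes {1..k i}"
    and u: "u \<in> sum_prod hadd hmul n k x"
    and v: "v \<in> sum_prod hadd hmul n (k \<circ> \<sigma>) (permuted \<sigma> \<tau> x)"
  \<comment> \<open>The inverse function is written \<open>inv_into UNIV\<close>, as \<open>inv\<close> stands for inverses in a group.\<close>
  let ?\<tau> = "\<lambda>i. inv_into UNIV (\<tau> (\<sigma> i))"
  have "sum_prod hadd hmul n ((k \<circ> \<sigma>) \<circ> inv_into UNIV \<sigma>)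
      (permuted (inv_into UNIV \<sigma>) ?\<tau> (permuted \<sigma> \<tau> x)) = sum_prod hadd hmul n k x"
    unfolding sum_prod_def
  proof (rule hop_iter_cong)
    fix i assume "i \<in> {1..n}"
    then show "hop_prod hmul (((k \<circ> \<sigma>) \<circ> inv_into UNIV \<sigma>) i)
        (permuted (inv_into UNIV \<sigma>) ?\<tau> (permuted \<sigma> \<tau> x) i) = hop_prod hmul (k i) (x i)"
      by (simp only: comp_def permutes_inverses(1)[OF \<sigma>] permutes_inverses(1)[OF \<tau>])
  qed
  then have u': "u \<in> sum_prod hadd hmul n ((k \<circ> \<sigma>) \<circ> inv_into UNIV \<sigma>)
      (permuted (inv_into UNIV \<sigma>) ?\<tau> (permuted \<sigma> \<tau> x))"
    using u by (simp only:)
  show "(v, u) \<in> alpha R hadd hmul"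
  proof (rule alphaI[where n = n and k = "k \<circ> \<sigma>" and x = "permuted \<sigma> \<tau> x"
        and \<sigma> = "inv_into UNIV \<sigma>" and \<tau> = ?\<tau>])
    show "?\<tau> i permutes {1..(k \<circ> \<sigma>) i}" if "i \<in> {1..n}" for i
    proof -
      have "\<sigma> i \<in> {1..n}" using that permutes_in_image[OF \<sigma>] by blast
      from permutes_inv[OF \<tau>[OF this]] show ?thesis by (simp only: comp_def)
    qed
    show "sum_prod_expr R n (k \<circ> \<sigma>) (permuted \<sigma> \<tau> x)" using x \<sigma> \<tau> by (rule permuted_expr)
  qed (fact n permutes_inv[OF \<sigma>] v u')+
qed

lemma alpha_add_right:
  assumes "(x, y) \<in> alpha R hadd hmul" "a \<in> R" "u \<in> hadd x a" "v \<in> hadd y a"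
  shows "(u, v) \<in> alpha R hadd hmul"
  using assms(1)
proof (rule alphaE)
  fix n k z \<sigma> \<tau>
  assume n: "1 \<le> n" and z: "sum_prod_expr R n k z" and \<sigma>: "\<sigma> permutes {1..n}"
    and \<tau>: "\<And>i. i \<in> {1..n} \<Longrightarrow> \<tau> i permutes {1..k i}"
    and x: "x \<in> sum_prod hadd hmul n k z"
    and y: "y \<in> sum_prod hadd hmul n (k \<circ> \<sigma>) (permuted \<sigma> \<tau> z)"
  let ?k = "k(Suc n := 1)" and ?z = "z(Suc n := \<lambda>_. a)" and ?\<tau> = "\<tau>(Suc n := id)"
  \<comment> \<open>A permutation of the indices up to \<open>n\<close> fixes the new index, so permuting commutes with appending.\<close>
  have last: "\<sigma> (Suc n) = Suc n" using \<sigma> by (rule permutes_not_in) simp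
  have ne: "\<sigma> i \<noteq> Suc n" if "i \<noteq> Suc n" for i
    using that last permutes_inj[OF \<sigma>] by (metis injD)
  have eqs: "(k \<circ> \<sigma>)(Suc n := 1) = ?k \<circ> \<sigma>"
    "(permuted \<sigma> \<tau> z)(Suc n := \<lambda>_. a) = permuted \<sigma> ?\<tau> ?z"
    using last ne by (auto simp: fun_eq_iff)
  have v: "v \<in> sum_prod hadd hmul (Suc n) (?k \<circ> \<sigma>) (permuted \<sigma> ?\<tau> ?z)"
    using sum_prod_append[OF n y assms(4)] unfolding eqs .
  show ?thesis
  proof (rule alphaI[where n = "Suc n" and k = ?k and x = ?z and \<sigma> = \<sigma> and \<tau> = ?\<tau>])
    show "\<sigma> permutes {1..Suc n}" using \<sigma> by (rule permutes_subset) auto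
    show "?\<tau> i permutes {1..?k i}" if "i \<in> {1..Suc n}" for i
      using that \<tau>[of i] by (cases "i = Suc n") (simp_all add: permutes_id)
    show "sum_prod_expr R (Suc n) ?k ?z" using z \<open>a \<in> R\<close> by (rule sum_prod_expr_append)
    show "u \<in> sum_prod hadd hmul (Suc n) ?k ?z" using n x assms(3) by (rule sum_prod_append)
    show "v \<in> sum_prod hadd hmul (Suc n) (?k \<circ> \<sigma>) (permuted \<sigma> ?\<tau> ?z)" by (fact v)
  qed simp
qed

lemma alpha_mult_right:
  assumes "(x, y) \<in> alpha R hadd hmul" "a \<in> R" "u \<in> hmul x a" "v \<in> hmul y a"
  shows "(u, v) \<in> alpha R hadd hmul"
  using assms(1)
proof (rule alphaE)
  fix n k z \<sigma> \<tau>
  assume n: "1 \<le> n" and z: "sum_prod_expr R n k z" and \<sigma>: "\<sigma> permutes {1..n}"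
    and \<tau>: "\<And>i. i \<in> {1..n} \<Longrightarrow> \<tau> i permutes {1..k i}"
    and x: "x \<in> sum_prod hadd hmul n k z"
    and y: "y \<in> sum_prod hadd hmul n (k \<circ> \<sigma>) (permuted \<sigma> \<tau> z)"
  let ?k = "\<lambda>i. Suc (k i)" and ?z = "\<lambda>i. (z i)(Suc (k i) := a)"
  \<comment> \<open>Likewise each \<open>\<tau> i\<close> fixes the position of the new factor.\<close>
  have fixed: "(permuted \<sigma> \<tau> z i)(Suc ((k \<circ> \<sigma>) i) := a) = permuted \<sigma> \<tau> ?z i" if "i \<in> {1..n}" for i
  proof -
    have p: "\<tau> (\<sigma> i) permutes {1..k (\<sigma> i)}" using that permutes_in_image[OF \<sigma>] \<tau> by blast
    have last: "\<tau> (\<sigma> i) (Suc (k (\<sigma> i))) = Suc (k (\<sigma> i))" using p by (rule permutes_not_in) simp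
    have "\<tau> (\<sigma> i) j \<noteq> Suc (k (\<sigma> i))" if "j \<noteq> Suc (k (\<sigma> i))" for j
      using that last permutes_inj[OF p] by (metis injD)
    then show ?thesis using last by (auto simp: fun_eq_iff)
  qed
  have "sum_prod hadd hmul n (\<lambda>i. Suc ((k \<circ> \<sigma>) i)) (\<lambda>i. (permuted \<sigma> \<tau> z i)(Suc ((k \<circ> \<sigma>) i) := a))
      = sum_prod hadd hmul n (?k \<circ> \<sigma>) (permuted \<sigma> \<tau> ?z)"
    unfolding sum_prod_def by (rule hop_iter_cong) (simp only: fixed[unfolded comp_def] comp_def)
  note v = sum_prod_append_factor[OF permuted_expr[OF z \<sigma> \<tau>] assms(2) y assms(4), unfolded this]
  show ?thesis
  proof (rule alphaI[where k = ?k and x = ?z and \<sigma> = \<sigma> and \<tau> = \<tau>, OF n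
        sum_prod_expr_append_factor[OF z assms(2)] \<sigma> _ sum_prod_append_factor[OF z assms(2) x assms(3)] v])
    show "\<tau> i permutes {1..?k i}" if "i \<in> {1..n}" for i
      using \<tau>[OF that] by (rule permutes_subset) auto
  qed
qed

lemma alpha_add_commute:
  assumes "x \<in> R" "y \<in> R" "u \<in> hadd x y" "v \<in> hadd y x"
  shows "(u, v) \<in> alpha R hadd hmul"
  by (rule alphaI[of 2 "\<lambda>_. 1" "\<lambda>i _. if i = 1 then x else y" "transpose 1 2" "\<lambda>_. id"])
    (use assms in \<open>auto simp: sum_prod_expr_def sum_prod_def hop_sets_def numeral_2_eq_2
       intro!: permutes_swap_id\<close>)

lemma alpha_mult_commute:
  assumes "x \<in> R" "y \<in> R" "u \<in> hmul x y" "v \<in> hmul y x"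
  shows "(u, v) \<in> alpha R hadd hmul"
  by (rule alphaI[of 1 "\<lambda>_. 2" "\<lambda>_ j. if j = 1 then x else y" id "\<lambda>_. transpose 1 2"])
    (use assms in \<open>auto simp: sum_prod_expr_def hop_prod_def hop_sets_def numeral_2_eq_2
       intro!: permutes_swap_id\<close>)

end

section \<open>The insertion relation\<close>

definition block_insertion :: "'a \<Rightarrow> nat \<Rightarrow> (nat \<Rightarrow> 'a) \<Rightarrow> nat \<Rightarrow> (nat \<Rightarrow> 'a) \<Rightarrow> bool"
  where "block_insertion e k x k' y \<longleftrightarrow>
    (\<exists>p l. 1 \<le> p \<and> p \<le> l \<and> l \<le> k' \<and> k' = k + (l - p + 1) \<and>
       (\<forall>t\<in>{1..k'}. (t < p \<longrightarrow> y t = x t) \<and> (p \<le> t \<and> t \<le> l \<longrightarrow> y t = e) \<and>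
          (l < t \<longrightarrow> y t = x (t + p - l - 1))))"

text \<open>Condition \<open>\<PP>\<^sub>e\<close> is a condition on each product separately: it is kept, or a block is
  inserted.\<close>

lemma cond_P_iff:
  "cond_P e m k x k' y \<longleftrightarrow>
    (\<forall>i\<in>{1..m}. k i = k' i \<and> (\<forall>j\<in>{1..k i}. x i j = y i j) \<or> block_insertion e (k i) (x i) (k' i) (y i))"
  (is "?L \<longleftrightarrow> (\<forall>i\<in>_. ?same i \<or> ?ins i)")
proof -
  have "?L \<longleftrightarrow> (\<forall>i\<in>{1..m}. ?same i) \<or>
      (\<exists>I. I \<subseteq> {1..m} \<and> I \<noteq> {} \<and> (\<forall>i\<in>{1..m} - I. ?same i) \<and> (\<forall>i\<in>I. ?ins i))"
    unfolding cond_P_def block_insertion_def by (auto 0 0 cong: conj_cong)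
  also have "\<dots> \<longleftrightarrow> (\<forall>i\<in>{1..m}. ?same i \<or> ?ins i)" (is "?A \<or> ?B \<longleftrightarrow> ?C")
  proof
    assume C: ?C
    show "?A \<or> ?B"
    proof (rule disjCI)
      assume "\<not> ?B"
      with C show ?A by (auto dest!: spec[of _ "{i \<in> {1..m}. ?ins i}"])
    qed
  qed blast
  finally show ?thesis .
qed

text \<open>The block keeps its position \<open>p..l\<close>; the appended factor lies behind it on both sides, at
  \<open>k + 1\<close> and at \<open>k' + 1 = (k + 1) + (l - p + 1)\<close>.\<close>

lemma block_insertion_append:
  assumes "block_insertion e k x k' y"
  shows "block_insertion e (Suc k) (x(Suc k := a)) (Suc k') (y(Suc k' := a))"
proof -
  obtain p l where pl: "1 \<le> p" "p \<le> l" "l \<le> k'" "k' = k + (l - p + 1)"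
    and y: "\<And>t. t \<in> {1..k'} \<Longrightarrow> (t < p \<longrightarrow> y t = x t) \<and> (p \<le> t \<and> t \<le> l \<longrightarrow> y t = e) \<and>
      (l < t \<longrightarrow> y t = x (t + p - l - 1))"
    using assms unfolding block_insertion_def by blast
  have "\<forall>t\<in>{1..Suc k'}. (t < p \<longrightarrow> (y(Suc k' := a)) t = (x(Suc k := a)) t) \<and>
      (p \<le> t \<and> t \<le> l \<longrightarrow> (y(Suc k' := a)) t = e) \<and>
      (l < t \<longrightarrow> (y(Suc k' := a)) t = (x(Suc k := a)) (t + p - l - 1))"
  proof
    fix t assume t: "t \<in> {1..Suc k'}"
    show "(t < p \<longrightarrow> (y(Suc k' := a)) t = (x(Suc k := a)) t) \<and>
      (p \<le> t \<and> t \<le> l \<longrightarrow> (y(Suc k' := a)) t = e) \<and>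
      (l < t \<longrightarrow> (y(Suc k' := a)) t = (x(Suc k := a)) (t + p - l - 1))"
    proof (cases "t = Suc k'")
      case True
      then show ?thesis using pl by auto
    next
      case False
      have "t < p \<Longrightarrow> t \<noteq> Suc k" "l < t \<Longrightarrow> t + p - l - 1 \<noteq> Suc k"
        using pl t False by auto
      then show ?thesis using y[of t] t False by auto
    qed
  qed
  then show ?thesis
    unfolding block_insertion_def using pl by (intro exI[of _ p] exI[of _ l]) auto
qed

text \<open>The oriented half of \<open>\<lambda>\<^sup>e\<^sub>\<times>\<close>, where the blocks are inserted on the right-hand side.\<close>

definition insertion_rel ::
  "'a set \<Rightarrow> ('a \<Rightarrow> 'a \<Rightarrow> 'a set) \<Rightarrow> ('a \<Rightarrow> 'a \<Rightarrow> 'a set) \<Rightarrow> 'a \<Rightarrow> 'a rel"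
  where "insertion_rel R hadd hmul e = {(u, v). \<exists>m k x k' y. 1 \<le> m \<and>
    sum_prod_expr R m k x \<and> sum_prod_expr R m k' y \<and> cond_P e m k x k' y \<and>
    u \<in> sum_prod hadd hmul m k x \<and> v \<in> sum_prod hadd hmul m k' y}"

lemma lambda_times_eq:
  "lambda_times R hadd hmul e = insertion_rel R hadd hmul e \<union> (insertion_rel R hadd hmul e)\<inverse>"
  unfolding lambda_times_def lambda_m_def Re_rel_def insertion_rel_def Let_def
  by (auto 0 0; fastforce)

context hyperring
begin

lemma insertion_rel_subset: "insertion_rel R hadd hmul e \<subseteq> R \<times> R"
  using sum_prod_closed by (fastforce simp: insertion_rel_def)

lemma insertion_rel_add_right:
  assumes "(x, y) \<in> insertion_rel R hadd hmul e" "a \<in> R" "u \<in> hadd x a" "v \<in> hadd y a"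
  shows "(u, v) \<in> insertion_rel R hadd hmul e"
proof -
  obtain m k z k' w where *: "1 \<le> m" "sum_prod_expr R m k z" "sum_prod_expr R m k' w"
    "cond_P e m k z k' w" "x \<in> sum_prod hadd hmul m k z" "y \<in> sum_prod hadd hmul m k' w"
    using assms(1) by (auto simp: insertion_rel_def)
  have "cond_P e (Suc m) (k(Suc m := 1)) (z(Suc m := \<lambda>_. a)) (k'(Suc m := 1)) (w(Suc m := \<lambda>_. a))"
    using *(4) by (auto simp: cond_P_iff)
  then show ?thesis
    unfolding insertion_rel_def
    using sum_prod_expr_append[OF *(2) assms(2)] sum_prod_expr_append[OF *(3) assms(2)]
      sum_prod_append[OF *(1,5) assms(3)] sum_prod_append[OF *(1,6) assms(4)] by fastforce
qed

lemma insertion_rel_mult_right: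
  assumes "(x, y) \<in> insertion_rel R hadd hmul e" "a \<in> R" "u \<in> hmul x a" "v \<in> hmul y a"
  shows "(u, v) \<in> insertion_rel R hadd hmul e"
proof -
  obtain m k z k' w where *: "1 \<le> m" "sum_prod_expr R m k z" "sum_prod_expr R m k' w"
    "cond_P e m k z k' w" "x \<in> sum_prod hadd hmul m k z" "y \<in> sum_prod hadd hmul m k' w"
    using assms(1) by (auto simp: insertion_rel_def)
  have "cond_P e m (\<lambda>i. Suc (k i)) (\<lambda>i. (z i)(Suc (k i) := a))
      (\<lambda>i. Suc (k' i)) (\<lambda>i. (w i)(Suc (k' i) := a))"
    using *(4) unfolding cond_P_iff by (fastforce intro: block_insertion_append)
  then show ?thesis
    unfolding insertion_rel_def
    using *(1) sum_prod_expr_append_factor[OF *(2) assms(2)] sum_prod_expr_append_factor[OF *(3) assms(2)]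
      sum_prod_append_factor[OF *(2) assms(2) *(5) assms(3)]
      sum_prod_append_factor[OF *(3) assms(2) *(6) assms(4)] by blast
qed

lemma insertion_rel_mult_unit:
  assumes "e \<in> R" "x \<in> R" "u \<in> hmul x e"
  shows "(x, u) \<in> insertion_rel R hadd hmul e"
proof -
  let ?y = "\<lambda>(_::nat) j::nat. if j = 1 then x else e"
  have "block_insertion e 1 (\<lambda>_. x) 2 (?y 1)"
    \<comment> \<open>The block is the single position \<open>p = l = 2\<close>.\<close>
    unfolding block_insertion_def by (intro exI[of _ 2]) auto
  then have "cond_P e 1 (\<lambda>_. 1) (\<lambda>_ _. x) (\<lambda>_. 2) ?y" by (auto simp: cond_P_iff)
  moreover have "u \<in> sum_prod hadd hmul 1 (\<lambda>_. 2) ?y"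
    using assms(3) by (auto simp: hop_prod_def numeral_2_eq_2 intro: hop_setsI)
  moreover have "x \<in> sum_prod hadd hmul 1 (\<lambda>_. 1) (\<lambda>_ _. x)" by simp
  moreover have "sum_prod_expr R 1 (\<lambda>_. 1) (\<lambda>_ _. x)" "sum_prod_expr R 1 (\<lambda>_. 2) ?y"
    using assms by (auto simp: sum_prod_expr_def)
  ultimately show ?thesis unfolding insertion_rel_def by blast
qed

section \<open>The fundamental relation\<close>

lemma Lambda_subset: "Lambda R hadd hmul e \<subseteq> R \<times> R"
  unfolding Lambda_def lambda_times_eq using alpha_subset insertion_rel_subset by blast

lemma Lambda_sym: "sym (Lambda R hadd hmul e)"
  unfolding Lambda_def lambda_times_eq by (intro sym_Un sym_Un_converse alpha_sym)

lemma Lambda_refl: "x \<in> R \<Longrightarrow> (x, x) \<in> Lambda R hadd hmul e"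
  by (auto simp: Lambda_def alpha_def alpha_n_def intro!: exI[of _ 0])

lemma Lambda_star_strongly_regular_add: "strongly_regular R hadd (Lambda_star R hadd hmul e)"
  unfolding Lambda_star_def
proof (rule add.strongly_regular_trancl[OF Lambda_subset Lambda_refl Lambda_sym])
  fix x y a u v assume "(x, y) \<in> Lambda R hadd hmul e" "a \<in> R" "u \<in> hadd x a" "v \<in> hadd y a"
  then show "(u, v) \<in> Lambda R hadd hmul e"
    unfolding Lambda_def lambda_times_eq using alpha_add_right insertion_rel_add_right by blast
qed (use alpha_add_commute in \<open>auto simp: Lambda_def\<close>)

lemma Lambda_star_strongly_regular_mult: "strongly_regular R hmul (Lambda_star R hadd hmul e)"
  unfolding Lambda_star_def
proof (rule mul.strongly_regular_trancl[OF Lambda_subset Lambda_refl Lambda_sym])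
  fix x y a u v assume "(x, y) \<in> Lambda R hadd hmul e" "a \<in> R" "u \<in> hmul x a" "v \<in> hmul y a"
  then show "(u, v) \<in> Lambda R hadd hmul e"
    unfolding Lambda_def lambda_times_eq using alpha_mult_right insertion_rel_mult_right by blast
qed (use alpha_mult_commute in \<open>auto simp: Lambda_def\<close>)

lemma quot_ring_Lambda_star_cring:
  assumes "e \<in> R"
  shows "cring (quot_ring R hadd hmul (Lambda_star R hadd hmul e) e)"
proof (rule quot_ring_cring[OF Lambda_star_strongly_regular_add Lambda_star_strongly_regular_mult])
  show "(x, u) \<in> Lambda_star R hadd hmul e" if "x \<in> R" "u \<in> hmul x e" for x u
    using insertion_rel_mult_unit[OF assms that] by (auto simp: Lambda_star_def Lambda_def lambda_times_eq)
qed (use assms alpha_add_commute alpha_mult_commute in \<open>auto simp: Lambda_star_def Lambda_def\<close>)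

end

theorem theorem5p2:
  fixes R :: "'a set" and hadd hmul :: "'a \<Rightarrow> 'a \<Rightarrow> 'a set" and e :: 'a
  assumes "hyperring R hadd hmul" and "e \<in> R"
  shows "let L = Lambda_star R hadd hmul e; Q = quot_ring R hadd hmul L e in
    strongly_regular R hadd L \<and> strongly_regular R hmul L \<and>
    (\<forall>a\<in>R. \<forall>b\<in>R.
       (\<forall>c\<in>hop_sets hadd (L `` {a}) (L `` {b}). L `` {a} \<oplus>\<^bsub>Q\<^esub> L `` {b} = L `` {c}) \<and>
       (\<forall>d\<in>hop_sets hmul (L `` {a}) (L `` {b}). L `` {a} \<otimes>\<^bsub>Q\<^esub> L `` {b} = L `` {d})) \<and>
    cring Q \<and> \<one>\<^bsub>Q\<^esub> = L `` {e}"
proof -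
  interpret hyperring R hadd hmul by fact
  note sra = Lambda_star_strongly_regular_add[of e]
  note srm = Lambda_star_strongly_regular_mult[of e]
  show ?thesis
    unfolding Let_def
    using sra srm add.quot_op_classes[OF sra] mul.quot_op_classes[OF srm]
      quot_ring_Lambda_star_cring[OF \<open>e \<in> R\<close>]
    by (simp add: quot_ring_def)
qed

end
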